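(* Let $M=\langle C,\chi,\ell\rangle$ and $M'=\langle C',\chi',\ell'\rangle$ be simplicial models and $f:M\to M'$ a morphism of simplicial models. Let $X$ be a facet of $C$ and let $\varphi\in\mathcal{L}_K$ be a formula which contains no negations except possibly directly in front of atomic propositions. Then $M',f(X)\models\varphi$ implies $M,X\models\varphi$.
   Context: Agents $A=\{a_0,\ldots,a_n\}$; $\mathit{AP}=\{p_{a,x}\mid a\in A,x\in\mathcal{V}\}$ for a countable value set $\mathcal{V}$, $\mathit{AP}_a=\{p_{a,x}\mid x\in\mathcal{V}\}$. $\mathcal{L}_K$ is generated by $\varphi::=p\mid\neg\varphi\mid(\varphi\wedge\varphi)\mid K_a\varphi$ with $p\in\mathit{AP}$, $a\in A$. A simplicial model $\langle C,\chi,\ell\rangle$ is a simplicial complex $C$ all of whose facets (maximal simplexes) have $n+1$ vertices, with a coloring $\chi:\mathcal{V}(C)\to A$ giving distinct colors to the vertices of each simplex, and a labeling $\ell:\mathcal{V}(C)\to\mathscr{P}(\mathit{AP})$ with $\ell(v)\subseteq\mathit{AP}_{\chi(v)}$; for a facet $X$, $\ell(X)=\bigcup_{v\in X}\ell(v)$. A morphism of simplicial models $f:M\to M'$ is a map on vertices sending simplexes to simplexes, preserving colors ($\chi'(f(v))=\chi(v)$) and labels ($\ell'(f(v))=\ell(v)$); it sends facets to facets. Semantics at facets: $M,X\models p$ iff $p\in\ell(X)$; negation and conjunction as usual; $M,X\models K_a\varphi$ iff for every facet $Y$ with $a\in\chi(X\cap Y)$, $M,Y\models\varphi$. *)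

theory Defs
  imports "HOL-Library.Countable" "HOL-Library.Cardinality"
begin

text \<open>
  The agents \<open>a\<^sub>0, \<dots>, a\<^sub>n\<close> are the elements of a type \<open>'a\<close> of class \<open>finite\<close>, so that
  \<open>n + 1 = CARD('a)\<close>; the values are the elements of a type \<open>'x\<close> of class \<open>countable\<close>.
\<close>

datatype ('a, 'x) atomic_prop = AP 'a 'x

definition AP_of :: "'a \<Rightarrow> ('a, 'x) atomic_prop set"
  where "AP_of a = {AP a x | x. True}"

datatype ('a, 'x) formula =
    Atom "('a, 'x) atomic_prop"
  | Neg "('a, 'x) formula"
  | Conj "('a, 'x) formula" "('a, 'x) formula"
  | Know 'a "('a, 'x) formula"

primrec negations_only_on_atoms :: "('a, 'x) formula \<Rightarrow> bool" where
  "negations_only_on_atoms (Atom p) = True"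
| "negations_only_on_atoms (Neg \<phi>) = (\<exists>p. \<phi> = Atom p)"
| "negations_only_on_atoms (Conj \<phi> \<psi>) =
    (negations_only_on_atoms \<phi> \<and> negations_only_on_atoms \<psi>)"
| "negations_only_on_atoms (Know a \<phi>) = negations_only_on_atoms \<phi>"

text \<open>
  A simplicial complex is given by its set of simplexes (nonempty finite sets of vertices);
  its vertices are those elements that occur in some simplex.
\<close>

definition simplicial_complex :: "'v set set \<Rightarrow> bool"
  where "simplicial_complex C \<longleftrightarrow>
    (\<forall>S\<in>C. finite S \<and> S \<noteq> {}) \<and>
    (\<forall>S\<in>C. \<forall>T. T \<subseteq> S \<and> T \<noteq> {} \<longrightarrow> T \<in> C)"

definition vertices :: "'v set set \<Rightarrow> 'v set"
  where "vertices C = \<Union>C"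

definition facets :: "'v set set \<Rightarrow> 'v set set"
  where "facets C = {X \<in> C. \<forall>Y\<in>C. X \<subseteq> Y \<longrightarrow> Y = X}"

text \<open>The functions \<open>color\<close> and \<open>label\<close> are relevant only on the vertices of the complex.\<close>

record ('v, 'a, 'x) simplicial_structure =
  simplexes :: "'v set set"
  color :: "'v \<Rightarrow> 'a"
  label :: "'v \<Rightarrow> ('a, 'x) atomic_prop set"

definition simplicial_model :: "('v, 'a::finite, 'x::countable) simplicial_structure \<Rightarrow> bool"
  where "simplicial_model M \<longleftrightarrow>
    simplicial_complex (simplexes M) \<and>
    (\<forall>X\<in>facets (simplexes M). card X = CARD('a)) \<and>
    (\<forall>S\<in>simplexes M. inj_on (color M) S) \<and>
    (\<forall>v\<in>vertices (simplexes M). label M v \<subseteq> AP_of (color M v))"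

definition facet_label ::
    "('v, 'a, 'x) simplicial_structure \<Rightarrow> 'v set \<Rightarrow> ('a, 'x) atomic_prop set"
  where "facet_label M X = (\<Union>v\<in>X. label M v)"

text \<open>
  The first condition, applied to singletons, makes \<open>f\<close> map vertices to vertices.
\<close>

definition simplicial_morphism ::
    "('v, 'a, 'x) simplicial_structure \<Rightarrow> ('w, 'a, 'x) simplicial_structure \<Rightarrow> ('v \<Rightarrow> 'w) \<Rightarrow> bool"
  where "simplicial_morphism M M' f \<longleftrightarrow>
    (\<forall>S\<in>simplexes M. f ` S \<in> simplexes M') \<and>
    (\<forall>v\<in>vertices (simplexes M). color M' (f v) = color M v) \<and>
    (\<forall>v\<in>vertices (simplexes M). label M' (f v) = label M v)"

primrec satisfies ::
    "('v, 'a, 'x) simplicial_structure \<Rightarrow> 'v set \<Rightarrow> ('a, 'x) formula \<Rightarrow> bool" where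
  "satisfies M X (Atom p) = (p \<in> facet_label M X)"
| "satisfies M X (Neg \<phi>) = (\<not> satisfies M X \<phi>)"
| "satisfies M X (Conj \<phi> \<psi>) = (satisfies M X \<phi> \<and> satisfies M X \<psi>)"
| "satisfies M X (Know a \<phi>) =
    (\<forall>Y\<in>facets (simplexes M). a \<in> color M ` (X \<inter> Y) \<longrightarrow> satisfies M Y \<phi>)"

end

theory Submission
  imports Defs
begin

text \<open>
  Since \<open>f\<close> preserves labels, atoms have the same truth value at \<open>X\<close> and \<open>f ` X\<close>. Facets
  sharing an \<open>a\<close>-colored vertex have images sharing an \<open>a\<close>-colored vertex, so knowledge at
  \<open>f ` X\<close> quantifies over at least the images of the facets accessible from \<open>X\<close>.
\<close>

lemma facet_vertex: "X \<in> facets C \<Longrightarrow> v \<in> X \<Longrightarrow> v \<in> vertices C"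
  by (auto simp: facets_def vertices_def)

lemma facet_label_image:
  assumes "simplicial_morphism M M' f" and "X \<in> facets (simplexes M)"
  shows "facet_label M' (f ` X) = facet_label M X"
  using assms facet_vertex[OF assms(2)]
  by (simp add: facet_label_def simplicial_morphism_def)

text \<open>
  The coloring bounds every simplex by \<open>CARD('a)\<close> vertices and makes \<open>f\<close> injective on
  simplexes, so the image of a facet already has the maximal possible size.
\<close>

lemma facet_image:
  fixes M :: "('v, 'a::finite, 'x::countable) simplicial_structure"
    and M' :: "('w, 'a, 'x) simplicial_structure"
  assumes M: "simplicial_model M" and M': "simplicial_model M'"
    and f: "simplicial_morphism M M' f" and X: "X \<in> facets (simplexes M)"
  shows "f ` X \<in> facets (simplexes M')"
proof -
  have XM: "X \<in> simplexes M" using X by (simp add: facets_def)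
  have color: "color M' (f v) = color M v" if "v \<in> X" for v
    using f facet_vertex[OF X that] by (simp add: simplicial_morphism_def)
  have "inj_on (color M) X" using M XM by (simp add: simplicial_model_def)
  \<comment> \<open>Two vertices of \<open>X\<close> with the same image have the same color, so
    they coincide.\<close>
  then have "inj_on f X" by (metis color inj_on_def)
  then have card: "card (f ` X) = CARD('a)"
    using M X by (simp add: card_image simplicial_model_def)
  have "Y = f ` X" if Y: "Y \<in> simplexes M'" and sub: "f ` X \<subseteq> Y" for Y
  proof -
    have "finite Y" and "inj_on (color M') Y"
      using M' Y by (auto simp: simplicial_model_def simplicial_complex_def)
    then have "card Y \<le> CARD('a)" by (intro card_inj_on_le) auto
    then show ?thesis using card_seteq[OF \<open>finite Y\<close> sub] card by simp
  qed
  then show ?thesis using f XM by (auto simp: facets_def simplicial_morphism_def)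
qed

theorem theorem9:
  fixes M :: "('v, 'a::finite, 'x::countable) simplicial_structure"
    and M' :: "('w, 'a, 'x) simplicial_structure"
    and f :: "'v \<Rightarrow> 'w"
    and X :: "'v set"
    and \<phi> :: "('a, 'x) formula"
  assumes "simplicial_model M"
    and "simplicial_model M'"
    and "simplicial_morphism M M' f"
    and "X \<in> facets (simplexes M)"
    and "negations_only_on_atoms \<phi>"
    and "satisfies M' (f ` X) \<phi>"
  shows "satisfies M X \<phi>"
  using assms(4-6)
\<comment> \<open>The facet must vary, since \<open>Know\<close> moves from \<open>X\<close> to
  other facets.\<close>
proof (induction \<phi> arbitrary: X)
  case (Atom p)
  then show ?case using facet_label_image[OF assms(3)] by simp
next
  case (Neg \<phi>)
  \<comment> \<open>Only an atom can be negated here, and equality of the two labels also transfers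
    its absence.\<close>
  then show ?case using facet_label_image[OF assms(3)] by auto
next
  case (Conj \<phi> \<psi>)
  then show ?case by simp
next
  case (Know a \<phi>)
  have "satisfies M Y \<phi>"
    if Y: "Y \<in> facets (simplexes M)" and a: "a \<in> color M ` (X \<inter> Y)" for Y
  proof -
    from a obtain v where v: "v \<in> X" "v \<in> Y" "a = color M v" by auto
    then have "color M' (f v) = a"
      using assms(3) facet_vertex[OF Y] by (simp add: simplicial_morphism_def)
    then have "a \<in> color M' ` (f ` X \<inter> f ` Y)" using v by blast
    \<comment> \<open>Knowledge ranges over facets only, so the image of \<open>Y\<close> has to be
      a facet of \<open>M'\<close>.\<close>
    then have "satisfies M' (f ` Y) \<phi>"
      using Know.prems(3) facet_image[OF assms(1-3) Y] by simp
    then show ?thesis using Know.IH[OF Y] Know.prems(2) by simp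
  qed
  then show ?case by simp
qed

end
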